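(* Assume that the per-step reward decomposes as $r_t(a)=f(t)\cdot g(a)$, where $f:\mathbb{N}\to\mathbb{R}_{>0}$ is a monotonically non-increasing scale factor (representing diminishing information gain) and $g:\mathcal{A}\to\mathbb{R}$ captures the relative quality of action $a$ that is approximately stationary across $t$. Then for any pair of actions $a_w,a_l\in\mathcal{A}$ with $g(a_w)>g(a_l)$, and prompt $x$ encoding the state $s_t$: 1. (Preference invariance.) The ordering $r_t(a_w)>r_t(a_l)$ holds for all $t$, since $f(t)\cdot g(a_w)>f(t)\cdot g(a_l)$ whenever $f(t)>0$. 2. (Value non-stationarity.) The state-value function $V_t(s)=\mathbb{E}_a[r_t(a)]=f(t)\cdot\mathbb{E}_a[g(a)]$ is non-stationary in $t$, with magnitude scaling as $f(t)$. 3. (DPO invariance.) The DPO objective $$\mathcal{L}_{\mathrm{DPO}}=-\mathbb{E}_{(x,y_w,y_l)}\left[\log\sigma\left(\beta\left[\log\frac{\pi_\phi(y_w\mid x)}{\pi_{\mathrm{ref}}(y_w\mid x)}-\log\frac{\pi_\phi(y_l\mid x)}{\pi_{\mathrm{ref}}(y_l\mid x)}\right]\right)\right]$$ depends only on the log-ratio difference $$\log\frac{\pi_\phi(a_w\mid x)}{\pi_{\mathrm{ref}}(a_w\mid x)}-\log\frac{\pi_\phi(a_l\mid x)}{\pi_{\mathrm{ref}}(a_l\mid x)},$$ which is independent of $f(t)$.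
   Context: The setting is sequential experimental design. $\mathcal{A}$ is the set of actions (candidate interventions, each setting a chosen variable of a structural causal model to a chosen value), $t\in\mathbb{N}$ indexes steps, $s_t$ is the state at step $t$, and $r_t(a)$ is the reward of action $a$ at step $t$. $\mathbb{E}_a$ denotes expectation over the action $a$ (given the state $s$). A policy $\pi(\cdot\mid x)$ is a probability distribution over actions given a text prompt $x$ that encodes the state; $\pi_\phi$ is the policy being trained and $\pi_{\mathrm{ref}}$ is a reference policy. DPO stands for Direct Preference Optimization: its objective is an expectation over triples $(x,y_w,y_l)$ of a prompt, a preferred action $y_w$ and a dispreferred action $y_l$ (here $y_w=a_w$, $y_l=a_l$), with $\sigma(z)=1/(1+e^{-z})$ the logistic function and $\beta$ a positive constant (the value used is $\beta=0.1$). Preference pairs are produced by ranking candidate actions by reward: the highest-reward candidate is labelled preferred over the lowest-reward candidate.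
   Formalization: The claim that V_t(s) is non-stationary fails for constant f or when E_a[g(a)] = 0; it is stated instead as: V_t(s) is non-stationary in t exactly when f is non-constant and E_a[g(a)] is nonzero (for states s where this expectation exists). *)

theory Defs
  imports "HOL-Probability.Probability"
begin

definition state_value :: "('s \<Rightarrow> 'a measure) \<Rightarrow> (nat \<Rightarrow> 'a \<Rightarrow> real) \<Rightarrow> nat \<Rightarrow> 's \<Rightarrow> real" where
  "state_value \<mu> r t s = (\<integral>a. r t a \<partial>\<mu> s)"

definition stationary :: "(nat \<Rightarrow> real) \<Rightarrow> bool" where
  "stationary V \<longleftrightarrow> (\<forall>t t'. V t = V t')"

definition logistic :: "real \<Rightarrow> real" where
  "logistic z = 1 / (1 + exp (- z))"

(* A policy maps a prompt to a distribution over actions.  Triples are (x, y_w, y_l).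
   The logarithms have their usual meaning when both policies give positive probability
   to y_w and y_l; elsewhere the library's totalised division and ln apply. *)

definition log_ratio_diff ::
    "('x \<Rightarrow> 'a pmf) \<Rightarrow> ('x \<Rightarrow> 'a pmf) \<Rightarrow> 'x \<times> 'a \<times> 'a \<Rightarrow> real" where
  "log_ratio_diff \<pi> \<pi>ref = (\<lambda>(x, yw, yl).
     ln (pmf (\<pi> x) yw / pmf (\<pi>ref x) yw) - ln (pmf (\<pi> x) yl / pmf (\<pi>ref x) yl))"

definition DPO_loss ::
    "real \<Rightarrow> ('x \<Rightarrow> 'a pmf) \<Rightarrow> ('x \<Rightarrow> 'a pmf) \<Rightarrow> ('x \<times> 'a \<times> 'a) pmf \<Rightarrow> real" where
  "DPO_loss \<beta> \<pi> \<pi>ref D =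
     - measure_pmf.expectation D (\<lambda>(x, yw, yl).
         ln (logistic (\<beta> * (ln (pmf (\<pi> x) yw / pmf (\<pi>ref x) yw)
                             - ln (pmf (\<pi> x) yl / pmf (\<pi>ref x) yl)))))"

(* Labelling of a candidate set C met at step t under prompt x: the candidate of highest
   reward is preferred, the one of lowest reward dispreferred.  Ties are broken by the
   choice operator inside arg_max_on and arg_min_on. *)

definition ranked_triple ::
    "(nat \<Rightarrow> 'a \<Rightarrow> real) \<Rightarrow> nat \<times> 'x \<times> 'a set \<Rightarrow> 'x \<times> 'a \<times> 'a" where
  "ranked_triple r = (\<lambda>(t, x, C). (x, arg_max_on (r t) C, arg_min_on (r t) C))"

definition preference_data ::
    "(nat \<Rightarrow> 'a \<Rightarrow> real) \<Rightarrow> (nat \<times> 'x \<times> 'a set) pmf \<Rightarrow> ('x \<times> 'a \<times> 'a) pmf" where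
  "preference_data r Q = map_pmf (ranked_triple r) Q"

end

theory Submission
  imports Defs
begin

text \<open>Multiplying by a positive factor preserves strict comparisons, so at every step the
  rewards order actions exactly as \<open>g\<close> does. Preference labels use this order alone, so
  the labelled data are the same for every positive scale factor; the DPO loss reads only these data
  and the two policies (\<open>ranked_triple_cong_order\<close>,
  \<open>DPO_loss_eq_log_ratio_diff\<close>). The value, by contrast, is linear in the reward and
  keeps the factor \<open>f t\<close> (\<open>state_value_scaled\<close>).\<close>

text \<open>The choice operator sees the rewards only through the predicates \<open>is_arg_max\<close> and
  \<open>is_arg_min\<close>, so order-equivalent rewards break ties in the same way.\<close>

lemma ranked_triple_cong_order:
  assumes "\<And>a b. r t a < r t b \<longleftrightarrow> r' t a < r' t b"
  shows "ranked_triple r (t, x, C) = ranked_triple r' (t, x, C)"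
  using assms
  by (simp add: ranked_triple_def arg_max_on_def arg_max_def is_arg_max_def
      arg_min_on_def arg_min_def is_arg_min_def)

text \<open>Strictness leaves one maximiser and one minimiser, so the choice operators have no
  freedom.\<close>

lemma ranked_triple_pair:
  assumes "r t al < r t aw"
  shows "ranked_triple r (t, x, {aw, al}) = (x, aw, al)"
proof -
  have "is_arg_max (r t) (\<lambda>a. a \<in> {aw, al}) = (\<lambda>a. a = aw)"
    and "is_arg_min (r t) (\<lambda>a. a \<in> {aw, al}) = (\<lambda>a. a = al)"
    using assms by (auto simp: is_arg_max_def is_arg_min_def fun_eq_iff)
  then show ?thesis
    by (simp add: ranked_triple_def arg_max_on_def arg_max_def arg_min_on_def arg_min_def)
qed

text \<open>Linearity of the integral; if \<open>g\<close> is not integrable, both sides are 0 by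
  the convention for such integrals.\<close>

lemma state_value_scaled:
  assumes "\<And>t a. r t a = f t * g a"
  shows "state_value \<mu> r t s = f t * (\<integral>a. g a \<partial>\<mu> s)"
  by (simp add: state_value_def assms)

text \<open>A nonzero \<open>c\<close> cancels from \<open>f t * c = f t' * c\<close>. With
  \<open>c\<close> the mean of \<open>g\<close>, a zero mean is the only way a varying
  \<open>f\<close> can give a constant value.\<close>

lemma stationary_mult_right_iff:
  "stationary (\<lambda>t. f t * c) \<longleftrightarrow> stationary f \<or> c = 0"
  by (auto simp: stationary_def)

lemma DPO_loss_eq_log_ratio_diff:
  "DPO_loss \<beta> \<pi> \<pi>ref D
     = - measure_pmf.expectation D (\<lambda>z. ln (logistic (\<beta> * log_ratio_diff \<pi> \<pi>ref z)))"
  by (simp add: DPO_loss_def log_ratio_diff_def case_prod_unfold)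

text \<open>Makes "depends only on" precise: the expectation sees its integrand only on the support
  of \<open>D\<close>.\<close>

lemma DPO_loss_cong:
  assumes "\<And>z. z \<in> set_pmf D \<Longrightarrow> log_ratio_diff \<pi> \<pi>ref z = log_ratio_diff \<pi>' \<pi>ref' z"
  shows "DPO_loss \<beta> \<pi> \<pi>ref D = DPO_loss \<beta> \<pi>' \<pi>ref' D"
  unfolding DPO_loss_eq_log_ratio_diff
  by (auto intro!: integral_cong_AE simp: AE_measure_pmf_iff assms)

lemma DPO_loss_return_pmf:
  "DPO_loss \<beta> \<pi> \<pi>ref (return_pmf z) = - ln (logistic (\<beta> * log_ratio_diff \<pi> \<pi>ref z))"
  by (simp add: DPO_loss_eq_log_ratio_diff)

theorem proposition4p2:
  fixes f :: "nat \<Rightarrow> real" and g :: "'a \<Rightarrow> real" and r :: "nat \<Rightarrow> 'a \<Rightarrow> real"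
    and \<mu> :: "'s \<Rightarrow> 'a measure"
    and st :: "nat \<Rightarrow> 's" and encode :: "'s \<Rightarrow> 'x"
    and \<pi>\<phi> \<pi>ref :: "'x \<Rightarrow> 'a pmf" and \<beta> :: real
    and aw al :: 'a
  assumes decomposition: "\<And>t a. r t a = f t * g a"
    and f_pos: "\<And>t. f t > 0"
    and f_mono: "antimono f"
    and action_distribution: "\<And>s. prob_space (\<mu> s)"
    and beta_pos: "\<beta> > 0"
    and better: "g aw > g al"
  shows
    \<comment> \<open>1. preference invariance\<close>
    "(\<forall>t. r t aw > r t al)
     \<and>
     \<comment> \<open>2. value non-stationarity\<close>
     (\<forall>s. integrable (\<mu> s) g \<longrightarrow>
        (\<forall>t. integrable (\<mu> s) (r t)
           \<and> state_value \<mu> r t s = f t * (\<integral>a. g a \<partial>\<mu> s)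
           \<and> \<bar>state_value \<mu> r t s\<bar> = f t * \<bar>\<integral>a. g a \<partial>\<mu> s\<bar>)
        \<and> (\<not> stationary (\<lambda>t. state_value \<mu> r t s)
             \<longleftrightarrow> \<not> stationary f \<and> (\<integral>a. g a \<partial>\<mu> s) \<noteq> 0))
     \<and>
     \<comment> \<open>3. DPO invariance, for the given pair at the prompt encoding the current state\<close>
     (\<forall>t. ranked_triple r (t, encode (st t), {aw, al}) = (encode (st t), aw, al)
        \<and> DPO_loss \<beta> \<pi>\<phi> \<pi>ref (return_pmf (ranked_triple r (t, encode (st t), {aw, al})))
          = - ln (logistic (\<beta> * log_ratio_diff \<pi>\<phi> \<pi>ref (encode (st t), aw, al))))
     \<and>
     \<comment> \<open>3. DPO invariance: the objective depends only on the log-ratio difference\<close>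
     (\<forall>D. DPO_loss \<beta> \<pi>\<phi> \<pi>ref D
          = - measure_pmf.expectation D (\<lambda>z. ln (logistic (\<beta> * log_ratio_diff \<pi>\<phi> \<pi>ref z)))
        \<and> (\<forall>\<pi>' \<pi>ref'.
             (\<forall>z \<in> set_pmf D. log_ratio_diff \<pi>\<phi> \<pi>ref z = log_ratio_diff \<pi>' \<pi>ref' z)
               \<longrightarrow> DPO_loss \<beta> \<pi>\<phi> \<pi>ref D = DPO_loss \<beta> \<pi>' \<pi>ref' D))
     \<and>
     \<comment> \<open>3. DPO invariance: neither changes when f is replaced by another scale factor\<close>
     (\<forall>f'. (\<forall>t. f' t > 0) \<longrightarrow> antimono f' \<longrightarrow>
        (\<forall>t x C. finite C \<longrightarrow> C \<noteq> {} \<longrightarrow>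
           log_ratio_diff \<pi>\<phi> \<pi>ref (ranked_triple r (t, x, C))
           = log_ratio_diff \<pi>\<phi> \<pi>ref (ranked_triple (\<lambda>t a. f' t * g a) (t, x, C)))
        \<and> (\<forall>Q. (\<forall>(t, x, C) \<in> set_pmf Q. finite C \<and> C \<noteq> {}) \<longrightarrow>
             DPO_loss \<beta> \<pi>\<phi> \<pi>ref (preference_data r Q)
             = DPO_loss \<beta> \<pi>\<phi> \<pi>ref (preference_data (\<lambda>t a. f' t * g a) Q)))"
proof -
  have order: "r t a < r t b \<longleftrightarrow> g a < g b" for t a b
    by (simp add: decomposition f_pos)
  \<comment> \<open>Both rewards induce the order of \<open>g\<close>, so even ties are broken
    alike.\<close>
  have ranking: "ranked_triple r (t, x, C) = ranked_triple (\<lambda>t a. f' t * g a) (t, x, C)"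
    if "\<forall>t. f' t > 0" for f' :: "nat \<Rightarrow> real" and t and x :: 'x and C
    by (rule ranked_triple_cong_order) (simp add: order that)
  have data: "preference_data r Q = preference_data (\<lambda>t a. f' t * g a) Q"
    if "\<forall>t. f' t > 0" for f' :: "nat \<Rightarrow> real" and Q :: "(nat \<times> 'x \<times> 'a set) pmf"
    unfolding preference_data_def by (rule map_pmf_cong) (auto simp: ranking[OF that])
  have pair: "ranked_triple r (t, x, {aw, al}) = (x, aw, al)" for t and x :: 'x
    by (rule ranked_triple_pair) (simp add: order better)
  have scaled_value: "integrable (\<mu> s) (r t)
      \<and> state_value \<mu> r t s = f t * (\<integral>a. g a \<partial>\<mu> s)
      \<and> \<bar>state_value \<mu> r t s\<bar> = f t * \<bar>\<integral>a. g a \<partial>\<mu> s\<bar>"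
    if "integrable (\<mu> s) g" for s t
  proof -
    have "r t = (\<lambda>a. f t * g a)"
      by (simp add: decomposition fun_eq_iff)
    then show ?thesis
      using that f_pos[of t]
      by (simp add: state_value_scaled[where f = f and g = g, OF decomposition] abs_mult)
  qed
  have value_stationary: "\<not> stationary (\<lambda>t. state_value \<mu> r t s)
      \<longleftrightarrow> \<not> stationary f \<and> (\<integral>a. g a \<partial>\<mu> s) \<noteq> 0" for s
    by (simp add: state_value_scaled[where f = f and g = g, OF decomposition] stationary_mult_right_iff)
  show ?thesis
  proof (intro conjI)
    show "\<forall>t. r t aw > r t al"
      by (simp add: order better)
  next
    show "\<forall>s. integrable (\<mu> s) g \<longrightarrow>
        (\<forall>t. integrable (\<mu> s) (r t)
           \<and> state_value \<mu> r t s = f t * (\<integral>a. g a \<partial>\<mu> s)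
           \<and> \<bar>state_value \<mu> r t s\<bar> = f t * \<bar>\<integral>a. g a \<partial>\<mu> s\<bar>)
        \<and> (\<not> stationary (\<lambda>t. state_value \<mu> r t s)
             \<longleftrightarrow> \<not> stationary f \<and> (\<integral>a. g a \<partial>\<mu> s) \<noteq> 0)"
      using scaled_value value_stationary by blast
  \<comment> \<open>Only the DPO claims remain; folding the expectation back into
    \<open>DPO_loss\<close> brings them to the form of \<open>DPO_loss_cong\<close>.\<close>
  qed (use ranking data in \<open>auto simp: pair DPO_loss_return_pmf DPO_loss_eq_log_ratio_diff[symmetric]
         intro: DPO_loss_cong\<close>)
qed

end
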